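(* Let $\psi_{*}\in\Psi$ and let $A(\psi_{*})=\{x\in\mathcal{X}:RB_{\Psi}(\psi_{*}\,|\,x)\geq 1\}$. (i) Among all measurable sets $E(\psi_{*})\subset\mathcal{X}$ satisfying $$M(E(\psi_{*})\,|\,\psi_{*})\geq M(A(\psi_{*})\,|\,\psi_{*}),$$ the prior probability $M(E(\psi_{*}))$ is minimized by $E(\psi_{*})=A(\psi_{*})$. (ii) For measurable $E(\psi_{*})\subset\mathcal{X}$, consider the prior probability of not obtaining evidence against $\psi_{*}$ when it is false, $$\int_{\Psi\backslash\{\psi_{*}\}}M(E(\psi_{*})\,|\,\psi)\,\Pi_{\Psi}(d\psi).$$ If $\Pi_{\Psi}(\{\psi_{*}\})=0$, then $E(\psi_{*})=A(\psi_{*})$ minimizes this quantity among all measurable $E(\psi_{*})$ satisfying $M(E(\psi_{*})\,|\,\psi_{*})\geq M(A(\psi_{*})\,|\,\psi_{*})$. If $\Pi_{\Psi}(\{\psi_{*}\})\neq 0$, then $E(\psi_{*})=A(\psi_{*})$ minimizes this quantity among all measurable $E(\psi_{*})$ satisfying $M(E(\psi_{*})\,|\,\psi_{*})=M(A(\psi_{*})\,|\,\psi_{*})$.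
   Context: Setting. $\{f_{\theta}:\theta\in\Theta\}$ is a statistical model of probability densities for data $x\in\mathcal{X}$ with respect to a common $\sigma$-finite support measure $\mu$ on $\mathcal{X}$, with $f_\theta(x)$ jointly measurable. $\Pi$ is a proper prior (a probability measure) on $\Theta$. $\Psi:\Theta\rightarrow\Psi$ is a measurable map that is onto (the same symbol denotes the map and its range), and $\psi=\Psi(\theta)$ is the quantity of interest. $\Pi_{\Psi}$ is the marginal prior of $\psi$ (singletons are measurable), and $\Pi(\cdot\,|\,\psi)$ is the conditional prior of $\theta$ given $\Psi(\theta)=\psi$, a regular conditional probability. Prior predictives. $m(x)=\int_{\Theta}f_{\theta}(x)\,\Pi(d\theta)$ is the prior predictive density and $M(B)=\int_{B}m(x)\,\mu(dx)$. The conditional prior predictive density given $\psi$ is $m(x\,|\,\psi)=\int_{\Theta}f_{\theta}(x)\,\Pi(d\theta\,|\,\psi)$, and $M(B\,|\,\psi)=\int_{B}m(x\,|\,\psi)\,\mu(dx)$. Thus $M(B)=\int_{\Psi}M(B\,|\,\psi)\,\Pi_{\Psi}(d\psi)$. Relative belief ratio. $RB_{\Psi}(\psi\,|\,x)$ is the ratio of the posterior density to the prior density of $\psi$, which equals $m(x\,|\,\psi)/m(x)$. The conditions $RB_{\Psi}(\psi\,|\,x)\le 1$, $<1$, $\ge 1$, $>1$ mean respectively $m(x\,|\,\psi)\le m(x)$, $<$, $\ge$, $>$. Principle of evidence: there is evidence in favor of $\psi$ when $RB_{\Psi}(\psi\,|\,x)>1$ and evidence against $\psi$ when $RB_{\Psi}(\psi\,|\,x)<1$.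 The set $E(\psi_{*})$ is the set of data values that, under some arbitrary evidence rule, do not lead to evidence against $\psi_{*}$. The set $A(\psi_{*})$ plays this role for the principle of evidence. *)

theory Defs
  imports "HOL-Probability.Probability"
begin

text \<open>Notation: \<open>\<mu>\<close> is the support measure on the sample space, \<open>P\<close> the prior on the parameter
  space, \<open>T\<close> the map from parameters to the quantity of interest with values in \<open>S\<close>,
  and \<open>K \<psi>\<close> the conditional prior of the parameter given \<open>T \<theta> = \<psi>\<close>.\<close>

definition marginal_prior :: "'t measure \<Rightarrow> 'p measure \<Rightarrow> ('t \<Rightarrow> 'p) \<Rightarrow> 'p measure" where
  "marginal_prior P S T = distr P S T"

definition regular_conditional_prior ::
    "'t measure \<Rightarrow> 'p measure \<Rightarrow> ('t \<Rightarrow> 'p) \<Rightarrow> ('p \<Rightarrow> 't measure) \<Rightarrow> bool" where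
  "regular_conditional_prior P S T K \<longleftrightarrow>
     K \<in> measurable S (prob_algebra P) \<and>
     (\<forall>A\<in>sets P. \<forall>B\<in>sets S.
        emeasure P (A \<inter> T -` B) = (\<integral>\<^sup>+\<psi>\<in>B. emeasure (K \<psi>) A \<partial>marginal_prior P S T))"

text \<open>Predictive densities are \<open>ennreal\<close>-valued, since the mixtures may be infinite on a
  \<open>\<mu>\<close>-null set.\<close>

definition pred_density :: "('t \<Rightarrow> 'x \<Rightarrow> real) \<Rightarrow> 't measure \<Rightarrow> 'x \<Rightarrow> ennreal" where
  "pred_density f P x = (\<integral>\<^sup>+\<theta>. ennreal (f \<theta> x) \<partial>P)"

definition cond_pred_density ::
    "('t \<Rightarrow> 'x \<Rightarrow> real) \<Rightarrow> ('p \<Rightarrow> 't measure) \<Rightarrow> 'p \<Rightarrow> 'x \<Rightarrow> ennreal" where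
  "cond_pred_density f K \<psi> x = (\<integral>\<^sup>+\<theta>. ennreal (f \<theta> x) \<partial>K \<psi>)"

definition prior_pred :: "'x measure \<Rightarrow> ('t \<Rightarrow> 'x \<Rightarrow> real) \<Rightarrow> 't measure \<Rightarrow> 'x measure" where
  "prior_pred \<mu> f P = density \<mu> (pred_density f P)"

definition cond_prior_pred ::
    "'x measure \<Rightarrow> ('t \<Rightarrow> 'x \<Rightarrow> real) \<Rightarrow> ('p \<Rightarrow> 't measure) \<Rightarrow> 'p \<Rightarrow> 'x measure" where
  "cond_prior_pred \<mu> f K \<psi> = density \<mu> (cond_pred_density f K \<psi>)"

text \<open>In \<open>ennreal\<close> both \<open>0 / 0\<close> and \<open>\<infinity> / \<infinity>\<close> are \<open>0\<close>. The ratio is set to \<open>1\<close> in these cases, so that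
  comparing it with \<open>1\<close> always amounts to comparing the two densities (\<open>RB_compare\<close>).\<close>

definition RB ::
    "('t \<Rightarrow> 'x \<Rightarrow> real) \<Rightarrow> 't measure \<Rightarrow> ('p \<Rightarrow> 't measure) \<Rightarrow> 'p \<Rightarrow> 'x \<Rightarrow> ennreal" where
  "RB f P K \<psi> x =
     (if cond_pred_density f K \<psi> x = pred_density f P x then 1
      else cond_pred_density f K \<psi> x / pred_density f P x)"

definition no_evidence_against ::
    "'x measure \<Rightarrow> ('t \<Rightarrow> 'x \<Rightarrow> real) \<Rightarrow> 't measure \<Rightarrow> ('p \<Rightarrow> 't measure) \<Rightarrow> 'p \<Rightarrow> 'x set" where
  "no_evidence_against \<mu> f P K \<psi> = {x \<in> space \<mu>. RB f P K \<psi> x \<ge> 1}"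

definition no_evidence_against_when_false ::
    "'x measure \<Rightarrow> ('t \<Rightarrow> 'x \<Rightarrow> real) \<Rightarrow> 't measure \<Rightarrow> 'p measure \<Rightarrow> ('t \<Rightarrow> 'p) \<Rightarrow>
     ('p \<Rightarrow> 't measure) \<Rightarrow> 'p \<Rightarrow> 'x set \<Rightarrow> ennreal" where
  "no_evidence_against_when_false \<mu> f P S T K \<psi>0 E =
     (\<integral>\<^sup>+\<psi>\<in>space S - {\<psi>0}. emeasure (cond_prior_pred \<mu> f K \<psi>) E \<partial>marginal_prior P S T)"

locale bayes_model = support: sigma_finite_measure \<mu> + prior: prob_space P
  for \<mu> :: "'x measure" and P :: "'t measure" +
  fixes f :: "'t \<Rightarrow> 'x \<Rightarrow> real"
    and S :: "'p measure"
    and T :: "'t \<Rightarrow> 'p"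
    and K :: "'p \<Rightarrow> 't measure"
  assumes f_measurable: "(\<lambda>(\<theta>, x). f \<theta> x) \<in> borel_measurable (P \<Otimes>\<^sub>M \<mu>)"
    and f_nonneg: "\<And>\<theta> x. \<theta> \<in> space P \<Longrightarrow> x \<in> space \<mu> \<Longrightarrow> 0 \<le> f \<theta> x"
    and f_density: "\<And>\<theta>. \<theta> \<in> space P \<Longrightarrow> (\<integral>\<^sup>+x. ennreal (f \<theta> x) \<partial>\<mu>) = 1"
    and T_measurable: "T \<in> measurable P S"
    and T_onto: "T ` space P = space S"
    and singleton_measurable: "\<And>\<psi>. \<psi> \<in> space S \<Longrightarrow> {\<psi>} \<in> sets S"
    and regular_conditional: "regular_conditional_prior P S T K"

lemma RB_compare:
  shows "RB f P K \<psi> x \<le> 1 \<longleftrightarrow> cond_pred_density f K \<psi> x \<le> pred_density f P x"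
    and "RB f P K \<psi> x < 1 \<longleftrightarrow> cond_pred_density f K \<psi> x < pred_density f P x"
    and "1 \<le> RB f P K \<psi> x \<longleftrightarrow> pred_density f P x \<le> cond_pred_density f K \<psi> x"
    and "1 < RB f P K \<psi> x \<longleftrightarrow> pred_density f P x < cond_pred_density f K \<psi> x"
proof -
  define a b where "a = cond_pred_density f K \<psi> x" and "b = pred_density f P x"
  have *: "(a / b \<le> 1 \<longleftrightarrow> a \<le> b) \<and> (1 \<le> a / b \<longleftrightarrow> b \<le> a)" if "a \<noteq> b" for a b :: ennreal
  proof (cases "b = 0 \<or> b = top")
    case True
    with that show ?thesis
      by (auto simp: ennreal_divide_top top_unique)
  next
    case False
    then show ?thesis
      by (cases a; cases b)
         (auto simp: divide_ennreal ennreal_top_divide divide_le_eq_1 le_divide_eq_1 top_unique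
               simp flip: ennreal_1)
  qed
  show "RB f P K \<psi> x \<le> 1 \<longleftrightarrow> cond_pred_density f K \<psi> x \<le> pred_density f P x"
       "1 \<le> RB f P K \<psi> x \<longleftrightarrow> pred_density f P x \<le> cond_pred_density f K \<psi> x"
    using *[of a b] by (auto simp: RB_def a_def b_def)
  then show "RB f P K \<psi> x < 1 \<longleftrightarrow> cond_pred_density f K \<psi> x < pred_density f P x"
       "1 < RB f P K \<psi> x \<longleftrightarrow> pred_density f P x < cond_pred_density f K \<psi> x"
    by (auto simp flip: not_le)
qed

text \<open>\<open>RB\<close> is the density of the posterior of \<open>\<psi>\<close> with respect to its prior.\<close>

lemma (in bayes_model) RB_posterior_density:
  assumes x: "x \<in> space \<mu>"
    and pos: "pred_density f P x \<noteq> 0" and fin: "pred_density f P x \<noteq> \<infinity>"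
  shows "distr (density P (\<lambda>\<theta>. ennreal (f \<theta> x) / pred_density f P x)) S T =
         density (marginal_prior P S T) (\<lambda>\<psi>. RB f P K \<psi> x)"
proof (rule measure_eqI)
  let ?m = "pred_density f P x"
  have K: "K \<in> measurable S (prob_algebra P)"
    and dis: "\<And>A B. A \<in> sets P \<Longrightarrow> B \<in> sets S \<Longrightarrow>
        emeasure P (A \<inter> T -` B) = (\<integral>\<^sup>+\<psi>\<in>B. emeasure (K \<psi>) A \<partial>distr P S T)"
    using regular_conditional by (auto simp: regular_conditional_prior_def marginal_prior_def)
  have K'[measurable]: "K \<in> measurable S (subprob_algebra P)"
    using K by (rule measurable_prob_algebraD)
  note T_measurable[measurable]
  have f[measurable]: "(\<lambda>\<theta>. f \<theta> x) \<in> borel_measurable P"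
    using measurable_compose[OF measurable_Pair2'[OF x] f_measurable] by simp
  have cm: "(\<lambda>\<psi>. cond_pred_density f K \<psi> x) \<in> borel_measurable S"
    unfolding cond_pred_density_def
    by (rule measurable_compose[OF K' nn_integral_measurable_subprob_algebra]) simp
  have RBeq: "RB f P K \<psi> x = cond_pred_density f K \<psi> x / ?m" for \<psi>
    using pos fin by (auto simp: RB_def ennreal_divide_self top.not_eq_extremum)
  show "sets (distr (density P (\<lambda>\<theta>. ennreal (f \<theta> x) / ?m)) S T) =
        sets (density (marginal_prior P S T) (\<lambda>\<psi>. RB f P K \<psi> x))"
    by (simp add: marginal_prior_def)
  fix B assume "B \<in> sets (distr (density P (\<lambda>\<theta>. ennreal (f \<theta> x) / ?m)) S T)"
  then have B[measurable]: "B \<in> sets S" by simp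
  have ne: "space S \<noteq> {}"
    using T_onto prior.not_empty by auto
  let ?D = "density (distr P S T) (indicator B)"
  have K''[measurable]: "K \<in> measurable ?D (subprob_algebra P)" by simp
  have bind: "density P (indicator (T -` B \<inter> space P)) = ?D \<bind> K"
  proof (rule measure_eqI)
    show "sets (density P (indicator (T -` B \<inter> space P))) = sets (?D \<bind> K)"
      using ne by (subst sets_bind[of _ _ P]) (auto dest: measurable_space[OF K'] simp: space_subprob_algebra)
    fix A assume "A \<in> sets (density P (indicator (T -` B \<inter> space P)))"
    then have A[measurable]: "A \<in> sets P" by simp
    have "emeasure (density P (indicator (T -` B \<inter> space P))) A = emeasure P (A \<inter> T -` B)"
      using sets.sets_into_space[OF A]
      by (subst emeasure_density)
         (auto simp flip: indicator_inter_arith intro!: arg_cong[where f="emeasure P"])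
    also have "\<dots> = emeasure (?D \<bind> K) A"
      using ne by (subst emeasure_bind[OF _ K'' A])
        (auto simp: dis nn_integral_density mult.commute intro!: nn_integral_cong)
    finally show "emeasure (density P (indicator (T -` B \<inter> space P))) A = emeasure (?D \<bind> K) A" .
  qed
  have "emeasure (distr (density P (\<lambda>\<theta>. ennreal (f \<theta> x) / ?m)) S T) B =
        (\<integral>\<^sup>+\<theta>. ennreal (f \<theta> x) / ?m * indicator (T -` B \<inter> space P) \<theta> \<partial>P)"
    by (simp add: emeasure_distr emeasure_density)
  also have "\<dots> = (\<integral>\<^sup>+\<theta>. ennreal (f \<theta> x) / ?m \<partial>density P (indicator (T -` B \<inter> space P)))"
    by (simp add: nn_integral_density mult.commute)
  also have "\<dots> = (\<integral>\<^sup>+\<psi>. (\<integral>\<^sup>+\<theta>. ennreal (f \<theta> x) / ?m \<partial>K \<psi>) \<partial>?D)"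
    unfolding bind by (rule nn_integral_bind[OF _ K'']) simp
  also have "\<dots> = (\<integral>\<^sup>+\<psi>. cond_pred_density f K \<psi> x / ?m \<partial>?D)"
  proof (rule nn_integral_cong)
    fix \<psi> assume "\<psi> \<in> space ?D"
    then have "sets (K \<psi>) = sets P"
      using measurable_space[OF K'] by (auto simp: space_subprob_algebra)
    then have "(\<lambda>\<theta>. ennreal (f \<theta> x)) \<in> borel_measurable (K \<psi>)"
      by (simp cong: measurable_cong_sets)
    then show "(\<integral>\<^sup>+\<theta>. ennreal (f \<theta> x) / ?m \<partial>K \<psi>) = cond_pred_density f K \<psi> x / ?m"
      by (simp add: nn_integral_divide cond_pred_density_def)
  qed
  also have "\<dots> = emeasure (density (marginal_prior P S T) (\<lambda>\<psi>. RB f P K \<psi> x)) B"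
    using cm unfolding RBeq marginal_prior_def
    by (simp add: nn_integral_density emeasure_density mult.commute)
  finally show "emeasure (distr (density P (\<lambda>\<theta>. ennreal (f \<theta> x) / ?m)) S T) B =
      emeasure (density (marginal_prior P S T) (\<lambda>\<psi>. RB f P K \<psi> x)) B" .
qed

end

theory Submission
  imports Defs
begin

text \<open>Part (i) is the Neyman--Pearson argument: \<open>A(\<psi>\<^sub>0)\<close> is the set where the density of \<open>M\<close> is at
  most that of \<open>M(\<cdot>|\<psi>\<^sub>0)\<close>, so trading \<open>A - E\<close> for \<open>E - A\<close> cannot lower \<open>M\<close> without lowering
  \<open>M(\<cdot>|\<psi>\<^sub>0)\<close> as well. Part (ii) follows because, by disintegration and Tonelli, \<open>M(E)\<close> equals the
  objective plus \<open>M(E|\<psi>\<^sub>0) \<Pi>\<^sub>\<Psi>({\<psi>\<^sub>0})\<close>, and this last term is zero in the first case and the same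
  finite number for all competitors in the second.\<close>

lemma neyman_pearson_minimal:
  fixes p q :: "'a \<Rightarrow> ennreal"
  assumes [measurable]: "p \<in> borel_measurable M" "q \<in> borel_measurable M" "E \<in> sets M"
    and fin: "emeasure (density M q) (space M) \<noteq> \<infinity>"
    and A: "A = {x \<in> space M. p x \<le> q x}"
    and le: "emeasure (density M q) A \<le> emeasure (density M q) E"
  shows "emeasure (density M p) A \<le> emeasure (density M p) E"
proof -
  let ?P = "emeasure (density M p)" and ?Q = "emeasure (density M q)"
  have [measurable]: "A \<in> sets M"
    unfolding A by measurable
  have split: "emeasure (density M r) X = emeasure (density M r) (X \<inter> Y) + emeasure (density M r) (X - Y)"
    if "X \<in> sets M" "Y \<in> sets M" for r :: "'a \<Rightarrow> ennreal" and X Y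
    using that by (subst plus_emeasure) (auto simp: Int_Diff_Un)
  \<comment> \<open>In \<open>ennreal\<close> a common summand cancels only if it is finite. The
    bound on the total \<open>q\<close>-mass makes the mass of \<open>A \<inter> E\<close> finite,
    so \<open>le\<close> reduces to the two set differences. For \<open>p\<close> the common part is
    only added back at the end, which is mere monotonicity.\<close>
  have "?Q (A \<inter> E) \<le> ?Q (space M)"
    by (rule emeasure_mono) (auto dest: sets.sets_into_space simp: A)
  with fin have "?Q (A \<inter> E) \<noteq> top"
    by (auto simp: top_unique)
  moreover have "?Q (A \<inter> E) + ?Q (A - E) \<le> ?Q (A \<inter> E) + ?Q (E - A)"
    using le split[of A E q] split[of E A q] by (simp add: Int_commute)
  ultimately have *: "?Q (A - E) \<le> ?Q (E - A)"
    by (simp add: ennreal_add_left_cancel_le)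
  \<comment> \<open>On \<open>A\<close> we have p \<le> q, outside \<open>A\<close> q < p, so the
    exchange inequality for \<open>q\<close> is sandwiched between the \<open>p\<close>-masses of
    the two differences.\<close>
  have "?P (A - E) \<le> ?Q (A - E)"
    by (simp add: emeasure_density, rule nn_integral_mono) (auto simp: A split: split_indicator)
  also note *
  also have "?Q (E - A) \<le> ?P (E - A)"
    by (simp add: emeasure_density, rule nn_integral_mono) (auto simp: A split: split_indicator)
  finally have "?P (A \<inter> E) + ?P (A - E) \<le> ?P (A \<inter> E) + ?P (E - A)"
    by (rule add_left_mono)
  then show ?thesis
    using split[of A E p] split[of E A p] by (simp add: Int_commute)
qed

lemma cond_prior_pred_eq: "cond_prior_pred \<mu> f K \<psi> = prior_pred \<mu> f (K \<psi>)"
  by (simp add: cond_prior_pred_def prior_pred_def cond_pred_density_def[abs_def]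
      pred_density_def[abs_def])

context bayes_model
begin

text \<open>An arbitrary mixing measure \<open>Q\<close> lets the same facts serve the prior
  \<open>P\<close> and, through \<open>cond_prior_pred_eq\<close>, every conditional prior
  \<open>K \<psi>\<close>. The second fact is Tonelli; the third follows since each sampling density
  integrates to 1.\<close>

lemma prior_pred_mixture:
  assumes Q: "prob_space Q" "sets Q = sets P"
  shows measurable_pred_density: "pred_density f Q \<in> borel_measurable \<mu>"
    and emeasure_prior_pred: "E \<in> sets \<mu> \<Longrightarrow>
      emeasure (prior_pred \<mu> f Q) E = (\<integral>\<^sup>+\<theta>. (\<integral>\<^sup>+x\<in>E. ennreal (f \<theta> x) \<partial>\<mu>) \<partial>Q)"
    and emeasure_prior_pred_space: "emeasure (prior_pred \<mu> f Q) (space \<mu>) = 1"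
proof -
  interpret Q: prob_space Q by fact
  interpret pair_sigma_finite Q \<mu> ..
  have f[measurable]: "(\<lambda>(\<theta>, x). f \<theta> x) \<in> borel_measurable (Q \<Otimes>\<^sub>M \<mu>)"
    using f_measurable Q(2) by (simp cong: measurable_cong_sets sets_pair_measure_cong)
  have space: "space Q = space P"
    using Q(2) by (rule sets_eq_imp_space_eq)
  show m[measurable]: "pred_density f Q \<in> borel_measurable \<mu>"
    unfolding pred_density_def[abs_def] by measurable
  show eq: "emeasure (prior_pred \<mu> f Q) E = (\<integral>\<^sup>+\<theta>. (\<integral>\<^sup>+x\<in>E. ennreal (f \<theta> x) \<partial>\<mu>) \<partial>Q)"
    if [measurable]: "E \<in> sets \<mu>" for E
  proof -
    have "emeasure (prior_pred \<mu> f Q) E = (\<integral>\<^sup>+x. (\<integral>\<^sup>+\<theta>. ennreal (f \<theta> x) * indicator E x \<partial>Q) \<partial>\<mu>)"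
      unfolding prior_pred_def
      by (subst emeasure_density)
        (auto simp: pred_density_def nn_integral_multc intro!: nn_integral_cong)
    also have "\<dots> = (\<integral>\<^sup>+\<theta>. (\<integral>\<^sup>+x\<in>E. ennreal (f \<theta> x) \<partial>\<mu>) \<partial>Q)"
      by (rule Fubini') measurable
    finally show ?thesis .
  qed
  have "(\<integral>\<^sup>+x\<in>space \<mu>. ennreal (f \<theta> x) \<partial>\<mu>) = 1" if "\<theta> \<in> space Q" for \<theta>
    using f_density[of \<theta>] that by (simp add: space cong: nn_integral_cong)
  then show "emeasure (prior_pred \<mu> f Q) (space \<mu>) = 1"
    by (simp add: eq Q.emeasure_space_1 cong: nn_integral_cong)
qed

lemma conditional_prior:
  assumes "\<psi> \<in> space S"
  shows prob_space_conditional_prior: "prob_space (K \<psi>)"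
    and sets_conditional_prior: "sets (K \<psi>) = sets P"
  using assms regular_conditional
  by (auto simp: regular_conditional_prior_def space_prob_algebra dest: measurable_space)

text \<open>The disintegration assumption speaks of sets only. As an identity of measures it
  extends, by \<open>nn_integral_bind\<close>, to integrals of nonnegative measurable functions of
  the parameter.\<close>

lemma prior_eq_bind: "marginal_prior P S T \<bind> K = P"
proof (rule measure_eqI)
  note T_measurable[measurable]
  have K: "K \<in> measurable (marginal_prior P S T) (subprob_algebra P)"
    using regular_conditional
    by (auto simp: regular_conditional_prior_def marginal_prior_def intro: measurable_prob_algebraD)
  have ne: "space (marginal_prior P S T) \<noteq> {}"
    using T_onto prior.not_empty by (auto simp: marginal_prior_def)
  show sets: "sets (marginal_prior P S T \<bind> K) = sets P"
    using ne by (intro sets_bind) (auto simp: sets_conditional_prior marginal_prior_def)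
  fix A assume "A \<in> sets (marginal_prior P S T \<bind> K)"
  then have A: "A \<in> sets P" by (simp add: sets)
  \<comment> \<open>The disintegration is used with all of \<open>space S\<close> as the
    conditioning event, which does not restrict \<open>A\<close>.\<close>
  have "A \<inter> T -` space S = A"
    using sets.sets_into_space[OF A] measurable_space[OF T_measurable] by auto
  then have "emeasure P A = (\<integral>\<^sup>+\<psi>\<in>space S. emeasure (K \<psi>) A \<partial>marginal_prior P S T)"
    using regular_conditional A unfolding regular_conditional_prior_def
    by (metis sets.top)
  also have "\<dots> = (\<integral>\<^sup>+\<psi>. emeasure (K \<psi>) A \<partial>marginal_prior P S T)"
    by (intro nn_integral_cong) (simp add: marginal_prior_def)
  also have "\<dots> = emeasure (marginal_prior P S T \<bind> K) A"
    by (rule emeasure_bind[OF ne K A, symmetric])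
  finally show "emeasure (marginal_prior P S T \<bind> K) A = emeasure P A" ..
qed

text \<open>The law of total probability over \<psi>, with the possible atom at
  \<open>\<psi>0\<close> split off. It links the objectives of parts (i) and (ii).\<close>

lemma prior_pred_decomposition:
  assumes \<psi>0: "\<psi>0 \<in> space S" and E: "E \<in> sets \<mu>"
  shows "emeasure (prior_pred \<mu> f P) E =
    emeasure (cond_prior_pred \<mu> f K \<psi>0) E * emeasure (marginal_prior P S T) {\<psi>0} +
    no_evidence_against_when_false \<mu> f P S T K \<psi>0 E"
proof -
  let ?N = "marginal_prior P S T" and ?g = "\<lambda>\<theta>. \<integral>\<^sup>+x\<in>E. ennreal (f \<theta> x) \<partial>\<mu>"
    and ?M = "\<lambda>\<psi>. emeasure (cond_prior_pred \<mu> f K \<psi>) E"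
  note E[measurable] f_measurable[measurable] singleton_measurable[OF \<psi>0, measurable]
  have [measurable_cong]: "sets ?N = sets S"
    by (simp add: marginal_prior_def)
  have spaceN: "space ?N = space S"
    by (simp add: marginal_prior_def)
  have K[measurable]: "K \<in> measurable ?N (subprob_algebra P)"
    using regular_conditional
    by (auto simp: regular_conditional_prior_def marginal_prior_def intro: measurable_prob_algebraD)
  have g: "?g \<in> borel_measurable P"
    by measurable
  have M_eq: "?M \<psi> = (\<integral>\<^sup>+\<theta>. ?g \<theta> \<partial>K \<psi>)" if "\<psi> \<in> space ?N" for \<psi>
    using that E
    by (simp add: cond_prior_pred_eq spaceN
        emeasure_prior_pred[OF prob_space_conditional_prior sets_conditional_prior])
  \<comment> \<open>Measurability of \<open>?M\<close> in \<psi> is obtained from this kernel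
    integral, with which it agrees on \<open>space ?N\<close>.\<close>
  have "(\<lambda>\<psi>. \<integral>\<^sup>+\<theta>. ?g \<theta> \<partial>K \<psi>) \<in> borel_measurable ?N"
    by (rule measurable_compose[OF K nn_integral_measurable_subprob_algebra[OF g]])
  then have [measurable]: "?M \<in> borel_measurable ?N"
    by (subst measurable_cong[OF M_eq])
  have "emeasure (prior_pred \<mu> f P) E = (\<integral>\<^sup>+\<theta>. ?g \<theta> \<partial>(?N \<bind> K))"
    by (simp add: emeasure_prior_pred prior.prob_space_axioms prior_eq_bind)
  also have "\<dots> = (\<integral>\<^sup>+\<psi>. ?M \<psi> \<partial>?N)"
    by (subst nn_integral_bind[OF g K]) (simp add: M_eq cong: nn_integral_cong)
  also have "\<dots> = (\<integral>\<^sup>+\<psi>. ?M \<psi>0 * indicator {\<psi>0} \<psi> + ?M \<psi> * indicator (space S - {\<psi>0}) \<psi> \<partial>?N)"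
    by (intro nn_integral_cong) (auto simp: spaceN split: split_indicator)
  also have "\<dots> = (\<integral>\<^sup>+\<psi>. ?M \<psi>0 * indicator {\<psi>0} \<psi> \<partial>?N) +
      (\<integral>\<^sup>+\<psi>\<in>space S - {\<psi>0}. ?M \<psi> \<partial>?N)"
    by (rule nn_integral_add) measurable
  also have "(\<integral>\<^sup>+\<psi>. ?M \<psi>0 * indicator {\<psi>0} \<psi> \<partial>?N) = ?M \<psi>0 * emeasure ?N {\<psi>0}"
    by (rule nn_integral_cmult_indicator) measurable
  finally show ?thesis
    by (simp add: no_evidence_against_when_false_def)
qed

text \<open>This finiteness licenses both cancellations in \<open>ennreal\<close>: in the exchange
  argument and of the atom term in part (ii).\<close>

lemma cond_prior_pred_finite:
  assumes "\<psi> \<in> space S"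
  shows "emeasure (cond_prior_pred \<mu> f K \<psi>) E \<noteq> \<infinity>"
proof -
  have "emeasure (cond_prior_pred \<mu> f K \<psi>) E \<le> emeasure (cond_prior_pred \<mu> f K \<psi>) (space \<mu>)"
    using emeasure_space[of "cond_prior_pred \<mu> f K \<psi>" E] by (simp add: cond_prior_pred_def)
  also have "\<dots> = 1"
    using assms
    by (simp add: cond_prior_pred_eq emeasure_prior_pred_space prob_space_conditional_prior
        sets_conditional_prior)
  finally show ?thesis
    by (auto simp: top_unique)
qed

lemma measurable_cond_pred_density:
  assumes "\<psi> \<in> space S"
  shows "cond_pred_density f K \<psi> \<in> borel_measurable \<mu>"
  using measurable_pred_density[OF conditional_prior[OF assms]]
  by (simp add: cond_pred_density_def[abs_def] pred_density_def[abs_def])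

text \<open>This is the form that \<open>neyman_pearson_minimal\<close> expects. Points where both
  densities are 0 or both are infinite belong to the set, because \<open>RB\<close> is 1 there by
  convention.\<close>

lemma no_evidence_against_eq:
  "no_evidence_against \<mu> f P K \<psi> = {x \<in> space \<mu>. pred_density f P x \<le> cond_pred_density f K \<psi> x}"
  by (simp add: no_evidence_against_def RB_compare)

lemma sets_no_evidence_against:
  assumes "\<psi> \<in> space S"
  shows "no_evidence_against \<mu> f P K \<psi> \<in> sets \<mu>"
proof -
  note measurable_cond_pred_density[OF assms, measurable]
    measurable_pred_density[OF prior.prob_space_axioms refl, measurable]
  show ?thesis
    unfolding no_evidence_against_eq by measurable
qed

lemma prior_pred_no_evidence_against_le:
  assumes \<psi>: "\<psi> \<in> space S" and E: "E \<in> sets \<mu>"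
    and le: "emeasure (cond_prior_pred \<mu> f K \<psi>) (no_evidence_against \<mu> f P K \<psi>)
      \<le> emeasure (cond_prior_pred \<mu> f K \<psi>) E"
  shows "emeasure (prior_pred \<mu> f P) (no_evidence_against \<mu> f P K \<psi>) \<le> emeasure (prior_pred \<mu> f P) E"
  unfolding prior_pred_def
  using cond_prior_pred_finite[OF \<psi>] le
  by (intro neyman_pearson_minimal[OF measurable_pred_density measurable_cond_pred_density[OF \<psi>] E _
        no_evidence_against_eq])
     (auto simp: cond_prior_pred_def prior.prob_space_axioms)

end

theorem theorem4:
  fixes \<mu> :: "'x measure" and P :: "'t measure" and f :: "'t \<Rightarrow> 'x \<Rightarrow> real"
    and S :: "'p measure" and T :: "'t \<Rightarrow> 'p" and K :: "'p \<Rightarrow> 't measure" and \<psi>0 :: 'p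
  assumes "bayes_model \<mu> P f S T K" and "\<psi>0 \<in> space S"
  shows "is_arg_min (\<lambda>E. emeasure (prior_pred \<mu> f P) E)
      (\<lambda>E. E \<in> sets \<mu> \<and>
         emeasure (cond_prior_pred \<mu> f K \<psi>0) E
           \<ge> emeasure (cond_prior_pred \<mu> f K \<psi>0) (no_evidence_against \<mu> f P K \<psi>0))
      (no_evidence_against \<mu> f P K \<psi>0) \<and>
    (emeasure (marginal_prior P S T) {\<psi>0} = 0 \<longrightarrow>
      is_arg_min (\<lambda>E. no_evidence_against_when_false \<mu> f P S T K \<psi>0 E)
        (\<lambda>E. E \<in> sets \<mu> \<and>
           emeasure (cond_prior_pred \<mu> f K \<psi>0) E
             \<ge> emeasure (cond_prior_pred \<mu> f K \<psi>0) (no_evidence_against \<mu> f P K \<psi>0))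
        (no_evidence_against \<mu> f P K \<psi>0)) \<and>
    (emeasure (marginal_prior P S T) {\<psi>0} \<noteq> 0 \<longrightarrow>
      is_arg_min (\<lambda>E. no_evidence_against_when_false \<mu> f P S T K \<psi>0 E)
        (\<lambda>E. E \<in> sets \<mu> \<and>
           emeasure (cond_prior_pred \<mu> f K \<psi>0) E
             = emeasure (cond_prior_pred \<mu> f K \<psi>0) (no_evidence_against \<mu> f P K \<psi>0))
        (no_evidence_against \<mu> f P K \<psi>0))"
proof -
  interpret bayes_model \<mu> P f S T K by fact
  note \<psi>0 = \<open>\<psi>0 \<in> space S\<close>
  let ?A = "no_evidence_against \<mu> f P K \<psi>0" and ?Q = "emeasure (cond_prior_pred \<mu> f K \<psi>0)"
    and ?N0 = "emeasure (marginal_prior P S T) {\<psi>0}"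
    and ?F = "no_evidence_against_when_false \<mu> f P S T K \<psi>0"
  note A = sets_no_evidence_against[OF \<psi>0]
  have min: "emeasure (prior_pred \<mu> f P) ?A \<le> emeasure (prior_pred \<mu> f P) E"
    if "E \<in> sets \<mu>" "?Q ?A \<le> ?Q E" for E
    using prior_pred_no_evidence_against_le[OF \<psi>0 that] .
  \<comment> \<open>Without an atom the product term vanishes, so \<open>?F\<close> coincides with
    the prior predictive probability.\<close>
  have null: "?F ?A \<le> ?F E" if "?N0 = 0" "E \<in> sets \<mu>" "?Q ?A \<le> ?Q E" for E
    using min[OF that(2,3)] that(1)
    by (simp add: prior_pred_decomposition[OF \<psi>0 A] prior_pred_decomposition[OF \<psi>0 that(2)])
  interpret N: prob_space "marginal_prior P S T"
    unfolding marginal_prior_def by (rule prior.prob_space_distr[OF T_measurable])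
  \<comment> \<open>Equality of the conditional probabilities makes the atom term the same for
    \<open>E\<close> and \<open>?A\<close>; being finite, it cancels. Under a mere inequality the
    term for \<open>E\<close> could be larger, and the bound on \<open>?F\<close> would not
    follow.\<close>
  have "?Q ?A * ?N0 \<noteq> top"
    using cond_prior_pred_finite[OF \<psi>0, of ?A] by (simp add: ennreal_mult_eq_top_iff)
  then have atom: "?F ?A \<le> ?F E" if "E \<in> sets \<mu>" "?Q E = ?Q ?A" for E
    using min[OF that(1)] that(2)
    by (simp add: prior_pred_decomposition[OF \<psi>0 A] prior_pred_decomposition[OF \<psi>0 that(1)]
        ennreal_add_left_cancel_le)
  show ?thesis
    using A min null atom by (auto simp: is_arg_min_def not_less)
qed

end
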